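(* Let $A\in\mathbb{R}^{m\times n}$, $B\in\mathbb{R}^{s\times n}$, $b\in\mathbb{R}^m$, $d\in\mathbb{R}^s$ with $\mathrm{rank}(B)=s$ and $A^TJA$ positive definite, where $J=\mathrm{diag}(I_p,-I_q)$, $p+q=m$. Let $x$ be the unique solution of the EILS problem $\min_{x\in\mathbb{R}^n}(b-Ax)^TJ(b-Ax)$ subject to $Bx=d$, let $L\in\mathbb{R}^{n\times k}$ with $\mathrm{rank}(L)=k$, and put $M=A^TJA$, $N=BM^{-1}B^T$, $P=B^TN^{-1}BM^{-1}-I_n$, $r=b-Ax$, $\lambda=-(BB^T)^{-1}BA^TJr$. Set $$\mathcal{M}_{mc}^{Ubd}=|L^TM^{-1}B^TN^{-1}|\left(|(d^{\ddagger})^{\ddagger}|+|(B^{\ddagger})^{\ddagger}||x|\right)+|L^TP^TM^{-1}A^TJ|\left(|(b^{\ddagger})^{\ddagger}|+|(A^{\ddagger})^{\ddagger}||x|\right)+|L^TM^{-1}P|\left(|((B^T)^{\ddagger})^{\ddagger}||\lambda|+|((A^T)^{\ddagger})^{\ddagger}||Jr|\right).$$ Then the projected mixed condition number $\kappa^m_{\infty L\mathcal{F}}$ (when $L^Tx\neq0$) and the projected componentwise condition number $\kappa^c_{\infty L\mathcal{F}}$ of the EILS problem (defined in the context) satisfy $$\kappa^m_{\infty L\mathcal{F}}(A,B,b,d)\le\frac{\|\mathcal{M}_{mc}^{Ubd}\|_\infty}{\|L^Tx\|_\infty},\qquad \kappa^c_{\infty L\mathcal{F}}(A,B,b,d)\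le\left\|\frac{\mathcal{M}_{mc}^{Ubd}}{|L^Tx|}\right\|_\infty.$$
   Context: Notation: $\mathrm{vec}(A)$ stacks the columns of $A$; $\mathrm{vec}(A,B,b,d)=[\mathrm{vec}(A)^T,\mathrm{vec}(B)^T,b^T,d^T]^T$; $\otimes$ is the Kronecker product $X\otimes Y=[x_{ij}Y]$. Absolute values are entrywise. For a real number $c$, $c^{\ddagger}=1/c$ if $c\ne0$ and $c^{\ddagger}=1$ if $c=0$, applied entrywise to vectors and matrices (so $(c^{\ddagger})^{\ddagger}=c$ if $c\ne0$ and $(0^{\ddagger})^{\ddagger}=1$). Entrywise division of vectors is $\frac{a}{b}:=\mathrm{diag}(b^{\ddagger})a$. The projected mixed and componentwise condition numbers are given by $$\kappa^m_{\infty L\mathcal{F}}(A,B,b,d)=\frac{\left\||L^T\mathcal{M}_{\mathcal{F}}|\,|\mathrm{vec}(A^{\ddagger},B^{\ddagger},b^{\ddagger},d^{\ddagger})^{\ddagger}|\right\|_\infty}{\|L^Tx\|_\infty},\qquad \kappa^c_{\infty L\mathcal{F}}(A,B,b,d)=\left\|\frac{|L^T\mathcal{M}_{\mathcal{F}}|\,|\mathrm{vec}(A^{\ddagger},B^{\ddagger},b^{\ddagger},d^{\ddagger})^{\ddagger}|}{|L^Tx|}\right\|_\infty,$$ where $\mathcal{M}_{\mathcal{F}}=[\Gamma,\,-\Omega,\,-P^TM^{-1}A^TJ,\,M^{-1}B^TN^{-1}]$, $\Gamma=x^T\otimes(P^TM^{-1}A^TJ)-(M^{-1}P)\otimes(Jr)^T$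 and $\Omega=(M^{-1}P)\otimes\lambda^T+x^T\otimes(M^{-1}B^TN^{-1})$. *)

theory Defs
  imports
    Complex_Main
    "Jordan_Normal_Form.Gauss_Jordan_Elimination"
    "Jordan_Normal_Form.DL_Rank"
begin

section \<open>Vectors and matrices\<close>

text \<open>Absolute values and the operation \<open>\<ddagger>\<close> act entrywise.\<close>

definition ddag :: "real \<Rightarrow> real" where
  "ddag c = (if c = 0 then 1 else 1 / c)"

abbreviation ddag_vec :: "real vec \<Rightarrow> real vec" where
  "ddag_vec \<equiv> map_vec ddag"

abbreviation ddag_mat :: "real mat \<Rightarrow> real mat" where
  "ddag_mat \<equiv> map_mat ddag"

abbreviation abs_vec :: "real vec \<Rightarrow> real vec" where
  "abs_vec \<equiv> map_vec abs"

abbreviation abs_mat :: "real mat \<Rightarrow> real mat" where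
  "abs_mat \<equiv> map_mat abs"

definition vec_divide :: "real vec \<Rightarrow> real vec \<Rightarrow> real vec" where
  "vec_divide a b = mat_diag (dim_vec b) (\<lambda>i. ddag_vec b $ i) *\<^sub>v a"

text \<open>The inserted \<open>0\<close> only matters for the vector of dimension \<open>0\<close>.\<close>

definition inf_norm :: "real vec \<Rightarrow> real" where
  "inf_norm v = Max (insert 0 ((\<lambda>i. \<bar>v $ i\<bar>) ` {..<dim_vec v}))"

text \<open>Column stacking: entry \<open>(i, j)\<close> goes to position \<open>i + j * dim_row A\<close>.\<close>

definition vec_of_mat :: "'a mat \<Rightarrow> 'a vec" where
  "vec_of_mat A = vec (dim_row A * dim_col A) (\<lambda>l. A $$ (l mod dim_row A, l div dim_row A))"

definition vec_data :: "real mat \<Rightarrow> real mat \<Rightarrow> real vec \<Rightarrow> real vec \<Rightarrow> real vec" where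
  "vec_data A B b d = vec_of_mat A @\<^sub>v vec_of_mat B @\<^sub>v b @\<^sub>v d"

definition kronecker :: "real mat \<Rightarrow> real mat \<Rightarrow> real mat" where
  "kronecker X Y = mat (dim_row X * dim_row Y) (dim_col X * dim_col Y)
     (\<lambda>(i, j). X $$ (i div dim_row Y, j div dim_col Y) * Y $$ (i mod dim_row Y, j mod dim_col Y))"

definition row_mat :: "real vec \<Rightarrow> real mat" where
  "row_mat v = mat_of_rows (dim_vec v) [v]"

definition append_cols :: "real mat \<Rightarrow> real mat \<Rightarrow> real mat" where
  "append_cols X Y = four_block_mat X Y (0\<^sub>m 0 (dim_col X)) (0\<^sub>m 0 (dim_col Y))"

text \<open>Only meaningful for invertible matrices.\<close>

definition minv :: "real mat \<Rightarrow> real mat" where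
  "minv X = the (mat_inverse X)"

definition pos_def_mat :: "real mat \<Rightarrow> bool" where
  "pos_def_mat X \<longleftrightarrow> X\<^sup>T = X \<and>
     (\<forall>v \<in> carrier_vec (dim_row X). v \<noteq> 0\<^sub>v (dim_row X) \<longrightarrow> 0 < v \<bullet> (X *\<^sub>v v))"


section \<open>The equality constrained indefinite least squares problem\<close>

text \<open>Here \<open>A\<close> has \<open>p + q\<close> rows.\<close>

definition sig_mat :: "nat \<Rightarrow> nat \<Rightarrow> real mat" where
  "sig_mat p q = four_block_mat (1\<^sub>m p) (0\<^sub>m p q) (0\<^sub>m q p) (- 1\<^sub>m q)"

definition eils_objective :: "nat \<Rightarrow> nat \<Rightarrow> real mat \<Rightarrow> real vec \<Rightarrow> real vec \<Rightarrow> real" where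
  "eils_objective p q A b x = (b - A *\<^sub>v x) \<bullet> (sig_mat p q *\<^sub>v (b - A *\<^sub>v x))"

definition is_eils_solution ::
    "nat \<Rightarrow> nat \<Rightarrow> real mat \<Rightarrow> real mat \<Rightarrow> real vec \<Rightarrow> real vec \<Rightarrow> real vec \<Rightarrow> bool" where
  "is_eils_solution p q A B b d x \<longleftrightarrow>
     x \<in> carrier_vec (dim_col A) \<and> B *\<^sub>v x = d \<and>
     (\<forall>y \<in> carrier_vec (dim_col A).
        B *\<^sub>v y = d \<longrightarrow> eils_objective p q A b x \<le> eils_objective p q A b y)"

definition eils_sol ::
    "nat \<Rightarrow> nat \<Rightarrow> real mat \<Rightarrow> real mat \<Rightarrow> real vec \<Rightarrow> real vec \<Rightarrow> real vec" where
  "eils_sol p q A B b d = (THE x. is_eils_solution p q A B b d x)"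

definition eils_M :: "nat \<Rightarrow> nat \<Rightarrow> real mat \<Rightarrow> real mat" where
  "eils_M p q A = A\<^sup>T * sig_mat p q * A"

definition eils_N :: "nat \<Rightarrow> nat \<Rightarrow> real mat \<Rightarrow> real mat \<Rightarrow> real mat" where
  "eils_N p q A B = B * minv (eils_M p q A) * B\<^sup>T"

definition eils_P :: "nat \<Rightarrow> nat \<Rightarrow> real mat \<Rightarrow> real mat \<Rightarrow> real mat" where
  "eils_P p q A B =
     B\<^sup>T * minv (eils_N p q A B) * B * minv (eils_M p q A) - 1\<^sub>m (dim_col A)"

definition eils_residual ::
    "nat \<Rightarrow> nat \<Rightarrow> real mat \<Rightarrow> real mat \<Rightarrow> real vec \<Rightarrow> real vec \<Rightarrow> real vec" where
  "eils_residual p q A B b d = b - A *\<^sub>v eils_sol p q A B b d"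

definition eils_multiplier ::
    "nat \<Rightarrow> nat \<Rightarrow> real mat \<Rightarrow> real mat \<Rightarrow> real vec \<Rightarrow> real vec \<Rightarrow> real vec" where
  "eils_multiplier p q A B b d =
     - (minv (B * B\<^sup>T) * B * A\<^sup>T * sig_mat p q *\<^sub>v eils_residual p q A B b d)"

definition eils_MF ::
    "nat \<Rightarrow> nat \<Rightarrow> real mat \<Rightarrow> real mat \<Rightarrow> real vec \<Rightarrow> real vec \<Rightarrow> real mat" where
  "eils_MF p q A B b d =
    (let J = sig_mat p q;
         x = eils_sol p q A B b d;
         r = eils_residual p q A B b d;
         lam = eils_multiplier p q A B b d;
         M_inv = minv (eils_M p q A);
         N_inv = minv (eils_N p q A B);
         P = eils_P p q A B;
         Gam = kronecker (row_mat x) (P\<^sup>T * M_inv * A\<^sup>T * J)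
               - kronecker (M_inv * P) (row_mat (J *\<^sub>v r));
         Om = kronecker (M_inv * P) (row_mat lam)
              + kronecker (row_mat x) (M_inv * B\<^sup>T * N_inv)
     in append_cols Gam (append_cols (- Om)
          (append_cols (- (P\<^sup>T * M_inv * A\<^sup>T * J)) (M_inv * B\<^sup>T * N_inv))))"


section \<open>Projected mixed and componentwise condition numbers\<close>

definition eils_weighted ::
    "nat \<Rightarrow> nat \<Rightarrow> real mat \<Rightarrow> real mat \<Rightarrow> real mat \<Rightarrow> real vec \<Rightarrow> real vec \<Rightarrow> real vec" where
  "eils_weighted p q L A B b d =
     abs_mat (L\<^sup>T * eils_MF p q A B b d) *\<^sub>v
     abs_vec (ddag_vec (vec_data (ddag_mat A) (ddag_mat B) (ddag_vec b) (ddag_vec d)))"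

definition mixed_cond ::
    "nat \<Rightarrow> nat \<Rightarrow> real mat \<Rightarrow> real mat \<Rightarrow> real mat \<Rightarrow> real vec \<Rightarrow> real vec \<Rightarrow> real" where
  "mixed_cond p q L A B b d =
     inf_norm (eils_weighted p q L A B b d) / inf_norm (L\<^sup>T *\<^sub>v eils_sol p q A B b d)"

definition componentwise_cond ::
    "nat \<Rightarrow> nat \<Rightarrow> real mat \<Rightarrow> real mat \<Rightarrow> real mat \<Rightarrow> real vec \<Rightarrow> real vec \<Rightarrow> real" where
  "componentwise_cond p q L A B b d =
     inf_norm (vec_divide (eils_weighted p q L A B b d)
       (abs_vec (L\<^sup>T *\<^sub>v eils_sol p q A B b d)))"


section \<open>Well-definedness of the solution and of the inverses\<close>

lemma minv_props:
  fixes X :: "real mat"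
  assumes X: "X \<in> carrier_mat n n"
    and inj: "\<And>v. v \<in> carrier_vec n \<Longrightarrow> X *\<^sub>v v = 0\<^sub>v n \<Longrightarrow> v = 0\<^sub>v n"
  shows "minv X \<in> carrier_mat n n" "X * minv X = 1\<^sub>m n" "minv X * X = 1\<^sub>m n"
proof -
  have "det X \<noteq> 0" using det_0_iff_vec_prod_zero_field[OF X] inj by auto
  then have "X \<in> Units (ring_mat TYPE(real) n ())" by (rule det_non_zero_imp_unit[OF X])
  then obtain Y where Y: "mat_inverse X = Some Y" using mat_inverse(1)[OF X, where b="()"] by fastforce
  from mat_inverse(2)[OF X Y]
  show "minv X \<in> carrier_mat n n" "X * minv X = 1\<^sub>m n" "minv X * X = 1\<^sub>m n"
    by (auto simp: minv_def Y)
qed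

lemma full_row_rank_surj:
  fixes B :: "real mat"
  assumes B: "B \<in> carrier_mat s n" and rk: "vec_space.rank s B = s" and y: "y \<in> carrier_vec s"
  shows "\<exists>z \<in> carrier_vec n. B *\<^sub>v z = y"
proof -
  interpret vec_space "TYPE(real)" s .
  have sub: "set (cols B) \<subseteq> carrier_vec s" using cols_dim B by blast
  obtain U where U: "finite U" "maximal U (\<lambda>T. T \<subseteq> set (cols B) \<and> lin_indpt T)"
    using maximal_exists_superset[of "set (cols B)" "\<lambda>T. T \<subseteq> set (cols B) \<and> lin_indpt T" "{}"]
    by (auto simp: lindep_span lin_dep_def)
  have c: "card U = s" using rank_card_indpt[OF B U(2)] rk by simp
  have U2: "U \<subseteq> set (cols B)" "lin_indpt U" using U(2) by (auto simp: maximal_def)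
  have "basis U"
    by (rule dim_li_is_basis) (use U U2 c sub in \<open>auto simp: dim_is_n fin_dim\<close>)
  then have "span U = carrier_vec s" by (auto simp: basis_def)
  then have "y \<in> span (set (cols B))" using y span_is_monotone[OF U2(1)] by auto
  have "y \<in> span_list (cols B)" using \<open>y \<in> span (set (cols B))\<close> span_list_as_span[OF sub] by simp
  then obtain c where c: "lincomb_list c (cols B) = y" by (auto simp: span_list_def)
  have "lincomb_list c (cols B) = mat_of_cols s (cols B) *\<^sub>v vec (length (cols B)) c"
    by (rule lincomb_list_as_mat_mult) (use sub in auto)
  then have "B *\<^sub>v vec n c = y" using c B by auto
  then show ?thesis by (intro bexI[of _ "vec n c"]) auto
qed


lemma sig_mat_carrier: "sig_mat p q \<in> carrier_mat (p + q) (p + q)"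
  by (auto simp: sig_mat_def)

lemma sig_mat_sym: "(sig_mat p q)\<^sup>T = sig_mat p q"
  by (auto simp: sig_mat_def intro!: eq_matI)

lemma pos_def_inv:
  assumes M: "M \<in> carrier_mat n n" and pd: "pos_def_mat M"
  shows "minv M \<in> carrier_mat n n" "M * minv M = 1\<^sub>m n" "minv M * M = 1\<^sub>m n"
proof -
  have inj: "v = 0\<^sub>v n" if v: "v \<in> carrier_vec n" "M *\<^sub>v v = 0\<^sub>v n" for v
  proof (rule ccontr)
    assume "v \<noteq> 0\<^sub>v n"
    then have "0 < v \<bullet> (M *\<^sub>v v)" using pd v M by (auto simp: pos_def_mat_def)
    then show False using v by simp
  qed
  show "minv M \<in> carrier_mat n n" "M * minv M = 1\<^sub>m n" "minv M * M = 1\<^sub>m n"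
    using minv_props[OF M inj] by auto
qed

lemma minv_mult_vec:
  assumes M: "M \<in> carrier_mat n n" and I: "minv M \<in> carrier_mat n n" "M * minv M = 1\<^sub>m n"
    and v: "v \<in> carrier_vec n"
  shows "M *\<^sub>v (minv M *\<^sub>v v) = v"
  unfolding assoc_mult_mat_vec[OF M I(1) v, symmetric] I(2) using v by simp

lemma schur_inj:
  fixes B :: "real mat"
  assumes M: "M \<in> carrier_mat n n" and pd: "pos_def_mat M"
    and B: "B \<in> carrier_mat s n" and rk: "vec_space.rank s B = s"
    and v: "v \<in> carrier_vec s" and z: "(B * minv M * B\<^sup>T) *\<^sub>v v = 0\<^sub>v s"
  shows "v = 0\<^sub>v s"
proof -
  note I = pos_def_inv[OF M pd]
  define u where "u = B\<^sup>T *\<^sub>v v"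
  define w where "w = minv M *\<^sub>v u"
  have u: "u \<in> carrier_vec n" using B v by (simp add: u_def)
  have w: "w \<in> carrier_vec n" using I u by (simp add: w_def)
  have Mw: "M *\<^sub>v w = u" unfolding w_def by (rule minv_mult_vec[OF M I(1,2) u])
  have Bw: "B *\<^sub>v w = 0\<^sub>v s"
    using z I(1) B v unfolding w_def u_def
    by (simp add: assoc_mult_mat_vec[of _ s n _ s] assoc_mult_mat_vec[of _ s n _ n])
  have "w \<bullet> (M *\<^sub>v w) = u \<bullet> w" unfolding Mw by (rule comm_scalar_prod[OF w u])
  also have "\<dots> = v \<bullet> (B *\<^sub>v w)" unfolding u_def by (rule transpose_vec_mult_scalar[OF B w v])
  also have "\<dots> = 0" using Bw v by simp
  finally have "w \<bullet> (M *\<^sub>v w) = 0" .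
  then have w0: "w = 0\<^sub>v n" using pd w M by (fastforce simp: pos_def_mat_def)
  have u0: "u = 0\<^sub>v n" using Mw w0 M by auto
  obtain t where t: "t \<in> carrier_vec n" "B *\<^sub>v t = v" using full_row_rank_surj[OF B rk v] by auto
  have "v \<bullet> v = u \<bullet> t" unfolding u_def using transpose_vec_mult_scalar[OF B t(1) v] t(2) by simp
  then have "v \<bullet> v = 0" using u0 t by simp
  have "\<forall>i<s. v $ i = 0"
    using \<open>v \<bullet> v = 0\<close> v unfolding scalar_prod_def by (auto simp: sum_nonneg_eq_0_iff)
  then show ?thesis using v by auto
qed

theorem ex1_eils_solution:
  assumes A: "A \<in> carrier_mat (p + q) n" and B: "B \<in> carrier_mat s n"
    and b: "b \<in> carrier_vec (p + q)" and d: "d \<in> carrier_vec s"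
    and rk: "vec_space.rank s B = s" and pd: "pos_def_mat (A\<^sup>T * sig_mat p q * A)"
  shows "\<exists>!x. is_eils_solution p q A B b d x"
proof -
  define J where "J = sig_mat p q"
  define M where "M = A\<^sup>T * J * A"
  define N where "N = B * minv M * B\<^sup>T"
  note J = sig_mat_carrier[of p q, folded J_def]
  have M: "M \<in> carrier_mat n n" using A J by (auto simp: M_def)
  have pd: "pos_def_mat M" using pd by (simp add: M_def J_def)
  note I = pos_def_inv[OF M pd]
  have N: "N \<in> carrier_mat s s" using B I by (auto simp: N_def)
  note IN = minv_props[OF N schur_inj[OF M pd B rk, folded N_def]]
  define g where "g = A\<^sup>T *\<^sub>v (J *\<^sub>v b)"
  have g: "g \<in> carrier_vec n" using A J b by (auto simp: g_def)
  define h where "h = minv M *\<^sub>v g"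
  have h: "h \<in> carrier_vec n" using I g by (simp add: h_def)
  define mu where "mu = minv N *\<^sub>v (d - B *\<^sub>v h)"
  have mu: "mu \<in> carrier_vec s" using IN B h d by (auto simp: mu_def)
  define x where "x = minv M *\<^sub>v (g + B\<^sup>T *\<^sub>v mu)"
  have Bmu: "B\<^sup>T *\<^sub>v mu \<in> carrier_vec n" using B mu by simp
  have x: "x \<in> carrier_vec n" using I g Bmu by (auto simp: x_def)
  have Mx: "M *\<^sub>v x = g + B\<^sup>T *\<^sub>v mu"
    unfolding x_def by (rule minv_mult_vec[OF M I(1,2)]) (use g Bmu in simp)
  have x2: "x = h + minv M *\<^sub>v (B\<^sup>T *\<^sub>v mu)" unfolding x_def h_def
    by (rule mult_add_distrib_mat_vec[OF I(1) g Bmu])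
  have "B *\<^sub>v x = B *\<^sub>v h + B *\<^sub>v (minv M *\<^sub>v (B\<^sup>T *\<^sub>v mu))"
    unfolding x2 by (rule mult_add_distrib_mat_vec[OF B h]) (use I Bmu in auto)
  also have "B *\<^sub>v (minv M *\<^sub>v (B\<^sup>T *\<^sub>v mu)) = N *\<^sub>v mu"
    unfolding N_def using B I(1) mu Bmu
    by (simp add: assoc_mult_mat_vec[of _ s n _ s] assoc_mult_mat_vec[of _ s n _ n])
  also have "N *\<^sub>v mu = d - B *\<^sub>v h"
    unfolding mu_def by (rule minv_mult_vec[OF N IN(1,2)]) (use B h d in auto)
  also have "B *\<^sub>v h + (d - B *\<^sub>v h) = d" using B h d by (intro eq_vecI) auto
  finally have Bx: "B *\<^sub>v x = d" .
  have key: "eils_objective p q A b y = eils_objective p q A b x + (y - x) \<bullet> (M *\<^sub>v (y - x))"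
    if y: "y \<in> carrier_vec n" and By: "B *\<^sub>v y = d" for y
  proof -
    define e where "e = y - x"
    define a where "a = A *\<^sub>v e"
    define r where "r = b - A *\<^sub>v x"
    have e: "e \<in> carrier_vec n" using x y by (simp add: e_def)
    have a: "a \<in> carrier_vec (p + q)" using A e by (simp add: a_def)
    have r: "r \<in> carrier_vec (p + q)" using A b x by (simp add: r_def)
    have Ja: "J *\<^sub>v a \<in> carrier_vec (p + q)" and Jr: "J *\<^sub>v r \<in> carrier_vec (p + q)"
      using J a r by auto
    have Be: "B *\<^sub>v e = 0\<^sub>v s" unfolding e_def
      using mult_minus_distrib_mat_vec[OF B y x] By Bx d by auto
    have "a = A *\<^sub>v y - A *\<^sub>v x" unfolding a_def e_def
      by (rule mult_minus_distrib_mat_vec[OF A y x])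
    then have res: "b - A *\<^sub>v y = r - a" using A b x y by (auto simp: r_def)
    have Jra: "J *\<^sub>v (r - a) = J *\<^sub>v r - J *\<^sub>v a" by (rule mult_minus_distrib_mat_vec[OF J r a])
    have sym: "r \<bullet> (J *\<^sub>v a) = a \<bullet> (J *\<^sub>v r)"
      using transpose_vec_mult_scalar[OF J a r] comm_scalar_prod[OF a Jr]
      by (simp add: J_def sig_mat_sym)
    have "A\<^sup>T *\<^sub>v (J *\<^sub>v r) = A\<^sup>T *\<^sub>v (J *\<^sub>v b - J *\<^sub>v (A *\<^sub>v x))"
      unfolding r_def using mult_minus_distrib_mat_vec[OF J b, of "A *\<^sub>v x"] A x by auto
    also have "\<dots> = g - A\<^sup>T *\<^sub>v (J *\<^sub>v (A *\<^sub>v x))"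
      unfolding g_def by (rule mult_minus_distrib_mat_vec[of _ n "p + q"]) (use A J b x in auto)
    also have "A\<^sup>T *\<^sub>v (J *\<^sub>v (A *\<^sub>v x)) = M *\<^sub>v x"
      unfolding M_def using A J x
      by (simp add: assoc_mult_mat_vec[of _ n "p + q" _ n] assoc_mult_mat_vec[of _ n "p + q" _ "p + q"])
    finally have grad: "A\<^sup>T *\<^sub>v (J *\<^sub>v r) = - (B\<^sup>T *\<^sub>v mu)" unfolding Mx using g Bmu by auto
    have "a \<bullet> (J *\<^sub>v r) = (J *\<^sub>v r) \<bullet> (A *\<^sub>v e)" unfolding a_def[symmetric] by (rule comm_scalar_prod[OF a Jr])
    also have "\<dots> = (A\<^sup>T *\<^sub>v (J *\<^sub>v r)) \<bullet> e" by (rule transpose_vec_mult_scalar[OF A e Jr, symmetric])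
    also have "\<dots> = - ((B\<^sup>T *\<^sub>v mu) \<bullet> e)" unfolding grad using uminus_scalar_prod[OF Bmu e] by simp
    also have "(B\<^sup>T *\<^sub>v mu) \<bullet> e = mu \<bullet> (B *\<^sub>v e)" by (rule transpose_vec_mult_scalar[OF B e mu])
    also have "\<dots> = 0" using Be mu by simp
    finally have cross: "a \<bullet> (J *\<^sub>v r) = 0" by simp
    have "e \<bullet> (M *\<^sub>v e) = e \<bullet> (A\<^sup>T *\<^sub>v (J *\<^sub>v a))"
      unfolding M_def a_def using A J e
      by (simp add: assoc_mult_mat_vec[of _ n "p + q" _ n] assoc_mult_mat_vec[of _ n "p + q" _ "p + q"])
    also have "\<dots> = (A\<^sup>T *\<^sub>v (J *\<^sub>v a)) \<bullet> e" by (rule comm_scalar_prod[OF e]) (use A Ja in auto)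
    also have "\<dots> = (J *\<^sub>v a) \<bullet> a" unfolding a_def[symmetric]
      using transpose_vec_mult_scalar[OF A e Ja] by (simp add: a_def)
    also have "\<dots> = a \<bullet> (J *\<^sub>v a)" by (rule comm_scalar_prod[OF Ja a])
    finally have quad: "a \<bullet> (J *\<^sub>v a) = e \<bullet> (M *\<^sub>v e)" by simp
    have "(r - a) \<bullet> (J *\<^sub>v r - J *\<^sub>v a) = r \<bullet> (J *\<^sub>v r - J *\<^sub>v a) - a \<bullet> (J *\<^sub>v r - J *\<^sub>v a)"
      by (rule minus_scalar_prod_distrib[OF r a]) (use Ja Jr in auto)
    also have "\<dots> = r \<bullet> (J *\<^sub>v r) - r \<bullet> (J *\<^sub>v a) - (a \<bullet> (J *\<^sub>v r) - a \<bullet> (J *\<^sub>v a))"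
      using scalar_prod_minus_distrib[OF r Jr Ja] scalar_prod_minus_distrib[OF a Jr Ja] by simp
    finally have "(r - a) \<bullet> (J *\<^sub>v r - J *\<^sub>v a) = r \<bullet> (J *\<^sub>v r) + e \<bullet> (M *\<^sub>v e)"
      using sym cross quad by simp
    then show ?thesis unfolding eils_objective_def J_def[symmetric] res Jra
      by (simp add: r_def e_def)
  qed
  have pos: "0 \<le> e \<bullet> (M *\<^sub>v e)" "e \<bullet> (M *\<^sub>v e) = 0 \<Longrightarrow> e = 0\<^sub>v n" if "e \<in> carrier_vec n" for e
  proof -
    have "e = 0\<^sub>v n \<or> 0 < e \<bullet> (M *\<^sub>v e)" using pd that M unfolding pos_def_mat_def by auto
    then show "0 \<le> e \<bullet> (M *\<^sub>v e)" "e \<bullet> (M *\<^sub>v e) = 0 \<Longrightarrow> e = 0\<^sub>v n"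
      using M that by auto
  qed
  show ?thesis
  proof (rule ex1I[of _ x])
    show "is_eils_solution p q A B b d x"
      unfolding is_eils_solution_def
    proof (intro conjI ballI impI)
      fix y assume y: "y \<in> carrier_vec (dim_col A)" "B *\<^sub>v y = d"
      then have "y \<in> carrier_vec n" using A by simp
      then show "eils_objective p q A b x \<le> eils_objective p q A b y"
        using key[of y] pos(1)[of "y - x"] y(2) x by simp
    qed (use x Bx A in auto)
  next
    fix y assume "is_eils_solution p q A B b d y"
    then have y: "y \<in> carrier_vec n" "B *\<^sub>v y = d" "eils_objective p q A b y \<le> eils_objective p q A b x"
      using A x Bx by (auto simp: is_eils_solution_def)
    have e: "y - x \<in> carrier_vec n" using x y by simp
    have "(y - x) \<bullet> (M *\<^sub>v (y - x)) = 0" using key[OF y(1,2)] y(3) pos(1)[OF e] by simp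
    then have z: "y - x = 0\<^sub>v n" using pos(2)[OF e] by simp
    show "y = x"
    proof (rule eq_vecI)
      fix i assume i: "i < dim_vec x"
      have "(y - x) $ i = 0" using z i x by simp
      then show "y $ i = x $ i" using i x y by simp
    qed (use x y in auto)
  qed
qed

end

(* The blocks of L^T MF belonging to A and B are sums of Kronecker products in which one factor is
   a row vector. By the triangle inequality and the identities (x^T (x) Y) vec A = Y A x and
   (Z (x) v^T) vec A = Z A^T v, applied to the matrices of absolute values, the weighted vector
   |L^T MF| |vec(A,B,b,d)| is entrywise at most Ubd. Both condition numbers are monotone in this
   nonnegative vector. *)

theory Submission
  imports Defs
begin

section \<open>Entrywise inequalities\<close>

lemma inf_norm_nonneg: "0 \<le> inf_norm v"
  unfolding inf_norm_def by (rule Max_ge) auto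

lemma inf_norm_mono:
  assumes "dim_vec v = dim_vec w" and "\<And>i. i < dim_vec w \<Longrightarrow> \<bar>v $ i\<bar> \<le> \<bar>w $ i\<bar>"
  shows "inf_norm v \<le> inf_norm w"
proof -
  have "\<bar>v $ i\<bar> \<le> inf_norm w" if "i < dim_vec w" for i
  proof -
    have "\<bar>w $ i\<bar> \<le> inf_norm w"
      unfolding inf_norm_def using that by (intro Max_ge) auto
    then show ?thesis using assms(2)[OF that] by linarith
  qed
  \<comment> \<open>The maximum also ranges over the inserted \<open>0\<close>, so
    \<open>0 \<le> inf_norm w\<close> is needed besides the bounds on the entries.\<close>
  then show ?thesis
    using inf_norm_nonneg[of w] assms(1) by (subst inf_norm_def) (auto intro!: Max.boundedI)
qed

lemma dim_vec_divide: "dim_vec (vec_divide a c) = dim_vec c"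
  by (simp add: vec_divide_def mat_diag_def)

text \<open>The diagonal matrix leaves a single summand. Where \<open>c $ i = 0\<close> the factor
  is \<open>ddag 0 = 1\<close>, so that entry of \<open>a\<close> is kept.\<close>

lemma index_vec_divide:
  assumes "dim_vec a = dim_vec c" and i: "i < dim_vec c"
  shows "vec_divide a c $ i = ddag (c $ i) * a $ i"
proof -
  have "vec_divide a c $ i = (\<Sum>j<dim_vec c. (if i = j then ddag (c $ j) else 0) * a $ j)"
    using assms by (auto simp: vec_divide_def mat_diag_def scalar_prod_def atLeast0LessThan
        intro!: sum.cong)
  also have "\<dots> = (\<Sum>j<dim_vec c. if i = j then ddag (c $ j) * a $ j else 0)"
    by (rule sum.cong) auto
  finally show ?thesis using i by simp
qed

text \<open>Both numerators get the same factor \<open>ddag (c $ i)\<close> in entry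
  \<open>i\<close>, so zero entries of \<open>c\<close> need no case distinction.\<close>

lemma inf_norm_vec_divide_mono:
  assumes "dim_vec u = dim_vec c" "dim_vec w = dim_vec c"
    and "\<And>i. i < dim_vec c \<Longrightarrow> \<bar>u $ i\<bar> \<le> \<bar>w $ i\<bar>"
  shows "inf_norm (vec_divide u c) \<le> inf_norm (vec_divide w c)"
  using assms by (intro inf_norm_mono)
    (auto simp: dim_vec_divide index_vec_divide abs_mult intro!: mult_left_mono)

text \<open>The triangle inequality holds in each matrix entry and survives summation because the
  weights \<open>w $ j\<close> are nonnegative.\<close>

lemma abs_mat_add_mult_vec_le:
  fixes X Y :: "real mat"
  assumes "X \<in> carrier_mat a c" "Y \<in> carrier_mat a c" "w \<in> carrier_vec c"
    and "\<And>j. j < c \<Longrightarrow> 0 \<le> w $ j" and "i < a"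
  shows "(abs_mat (X + Y) *\<^sub>v w) $ i \<le> (abs_mat X *\<^sub>v w) $ i + (abs_mat Y *\<^sub>v w) $ i"
proof -
  have "(\<Sum>j\<in>{0..<c}. \<bar>X $$ (i, j) + Y $$ (i, j)\<bar> * w $ j)
      \<le> (\<Sum>j\<in>{0..<c}. \<bar>X $$ (i, j)\<bar> * w $ j + \<bar>Y $$ (i, j)\<bar> * w $ j)"
    using assms(4) by (intro sum_mono) (auto simp: distrib_right[symmetric] intro!: mult_right_mono)
  then show ?thesis using assms by (simp add: scalar_prod_def sum.distrib)
qed

lemma abs_mat_uminus: "abs_mat (- X) = abs_mat X"
  by (auto intro!: eq_matI)

lemma abs_mat_mult_vec_nonneg:
  fixes X :: "real mat"
  assumes "X \<in> carrier_mat a c" "w \<in> carrier_vec c"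
    and "\<And>j. j < c \<Longrightarrow> 0 \<le> w $ j" and "i < a"
  shows "0 \<le> (abs_mat X *\<^sub>v w) $ i"
  using assms by (auto simp: scalar_prod_def intro!: sum_nonneg)


section \<open>Block rows and Kronecker products\<close>

lemma append_cols_carrier:
  "X \<in> carrier_mat a c \<Longrightarrow> Y \<in> carrier_mat a e \<Longrightarrow> append_cols X Y \<in> carrier_mat a (c + e)"
  by (auto simp: append_cols_def)

lemma append_cols_index:
  assumes "X \<in> carrier_mat a c" "Y \<in> carrier_mat a e" "i < a" "j < c + e"
  shows "append_cols X Y $$ (i, j) = (if j < c then X $$ (i, j) else Y $$ (i, j - c))"
  using assms by (auto simp: append_cols_def)

lemma mult_append_cols:
  fixes K :: "real mat"
  assumes "K \<in> carrier_mat k a" "X \<in> carrier_mat a c" "Y \<in> carrier_mat a e"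
  shows "K * append_cols X Y = append_cols (K * X) (K * Y)"
  using assms append_cols_carrier[OF assms(2,3)] append_cols_carrier[of "K * X" k c "K * Y" e]
  by (intro eq_matI) (auto simp: append_cols_index[of _ k c _ e] append_cols_index[of _ a c _ e]
      scalar_prod_def intro!: sum.cong)

lemma abs_mat_append_cols:
  assumes "X \<in> carrier_mat a c" "Y \<in> carrier_mat a e"
  shows "abs_mat (append_cols X Y) = append_cols (abs_mat X) (abs_mat Y)"
  using assms append_cols_carrier[OF assms] append_cols_carrier[of "abs_mat X" a c "abs_mat Y" e]
  by (intro eq_matI) (auto simp: append_cols_index[of _ a c _ e])

text \<open>Each row of the block matrix is a concatenation of two rows, so its scalar product with
  \<open>u @\<^sub>v w\<close> splits.\<close>

lemma append_cols_mult_vec: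
  assumes X: "X \<in> carrier_mat a c" and Y: "Y \<in> carrier_mat a e"
    and u: "u \<in> carrier_vec c" and w: "w \<in> carrier_vec e"
  shows "append_cols X Y *\<^sub>v (u @\<^sub>v w) = X *\<^sub>v u + Y *\<^sub>v w"
proof (rule eq_vecI)
  fix i assume "i < dim_vec (X *\<^sub>v u + Y *\<^sub>v w)"
  then have i: "i < a" using Y by simp
  have "row (append_cols X Y) i = row X i @\<^sub>v row Y i"
    using X Y i append_cols_carrier[OF X Y] by (intro eq_vecI) (auto simp: append_cols_index[OF X Y])
  then show "(append_cols X Y *\<^sub>v (u @\<^sub>v w)) $ i = (X *\<^sub>v u + Y *\<^sub>v w) $ i"
    using X Y u w i append_cols_carrier[OF X Y]
    by (simp add: scalar_prod_append[of _ c _ e])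
qed (use X Y append_cols_carrier[OF X Y] in auto)

section \<open>Kronecker products with a row vector as one factor\<close>

lemma kronecker_carrier:
  "X \<in> carrier_mat a c \<Longrightarrow> Y \<in> carrier_mat a' c' \<Longrightarrow> kronecker X Y \<in> carrier_mat (a * a') (c * c')"
  by (auto simp: kronecker_def)

lemma row_mat_carrier: "v \<in> carrier_vec c \<Longrightarrow> row_mat v \<in> carrier_mat 1 c"
  by (auto simp: row_mat_def)

lemma row_mat_index: "j < dim_vec v \<Longrightarrow> row_mat v $$ (0, j) = v $ j"
  by (simp add: row_mat_def mat_of_rows_def)

text \<open>Column \<open>l\<close> of such a product lies in block \<open>l div m\<close> at offset
  \<open>l mod m\<close>; both must be in range before entries can be looked up.\<close>

lemma div_mod_less_product:
  fixes l :: nat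
  assumes "l < n * m"
  shows "l div m < n" "l mod m < m"
proof -
  have "0 < m" using assms by (cases m) auto
  then show "l div m < n" "l mod m < m" using assms by (auto simp: less_mult_imp_div_less)
qed

text \<open>The left factor has one row, so row \<open>i\<close> of the product is
  \<open>(i div a, i mod a) = (0, i)\<close> in terms of the factors.\<close>

lemma kronecker_row_mat_left_index:
  assumes "Y \<in> carrier_mat a m" "v \<in> carrier_vec n" "i < a" "l < n * m"
  shows "kronecker (row_mat v) Y $$ (i, l) = v $ (l div m) * Y $$ (i, l mod m)"
  using assms row_mat_carrier[OF assms(2)] div_mod_less_product[OF assms(4)]
  by (auto simp: kronecker_def row_mat_index)

text \<open>Here the right factor has one row, so row \<open>i\<close> decodes as
  \<open>(i div 1, i mod 1) = (i, 0)\<close>.\<close>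

lemma kronecker_row_mat_right_index:
  assumes "Z \<in> carrier_mat a n" "v \<in> carrier_vec m" "i < a" "l < n * m"
  shows "kronecker Z (row_mat v) $$ (i, l) = Z $$ (i, l div m) * v $ (l mod m)"
  using assms row_mat_carrier[OF assms(2)] div_mod_less_product[OF assms(4)]
  by (auto simp: kronecker_def row_mat_index)

lemma kronecker_row_mat_left_carrier:
  "Y \<in> carrier_mat a m \<Longrightarrow> v \<in> carrier_vec n \<Longrightarrow> kronecker (row_mat v) Y \<in> carrier_mat a (n * m)"
  using kronecker_carrier[OF row_mat_carrier, of v n Y a m] by simp

lemma kronecker_row_mat_right_carrier:
  "Z \<in> carrier_mat a n \<Longrightarrow> v \<in> carrier_vec m \<Longrightarrow> kronecker Z (row_mat v) \<in> carrier_mat a (n * m)"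
  using kronecker_carrier[OF _ row_mat_carrier, of Z a n v m] by simp

lemmas kronecker_row_mat_carrier = kronecker_row_mat_left_carrier kronecker_row_mat_right_carrier

text \<open>A case of the mixed-product rule: \<open>K\<close> equals its Kronecker product with the
  1-by-1 identity on the left, so it acts on the factor \<open>Y\<close> only.\<close>

lemma mult_kronecker_row_mat_left:
  assumes K: "K \<in> carrier_mat k a" and Y: "Y \<in> carrier_mat a m" and v: "v \<in> carrier_vec n"
  shows "K * kronecker (row_mat v) Y = kronecker (row_mat v) (K * Y)"
proof (rule eq_matI)
  have KY: "K * Y \<in> carrier_mat k m" using K Y by simp
  note C = kronecker_row_mat_left_carrier[OF Y v] kronecker_row_mat_left_carrier[OF KY v]
  fix i l assume "i < dim_row (kronecker (row_mat v) (K * Y))"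
    and "l < dim_col (kronecker (row_mat v) (K * Y))"
  then have i: "i < k" and l: "l < n * m" using C(2) by auto
  show "(K * kronecker (row_mat v) Y) $$ (i, l) = kronecker (row_mat v) (K * Y) $$ (i, l)"
    using K Y C i l div_mod_less_product[OF l]
    by (auto simp: kronecker_row_mat_left_index[OF Y v] kronecker_row_mat_left_index[OF KY v]
        scalar_prod_def sum_distrib_left intro!: sum.cong)
qed (use K Y kronecker_row_mat_left_carrier[OF Y v]
      kronecker_row_mat_left_carrier[OF mult_carrier_mat[OF K Y] v] in auto)

text \<open>The mirror case, with the 1-by-1 identity on the right of \<open>K\<close>.\<close>

lemma mult_kronecker_row_mat_right:
  assumes K: "K \<in> carrier_mat k a" and Z: "Z \<in> carrier_mat a n" and v: "v \<in> carrier_vec m"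
  shows "K * kronecker Z (row_mat v) = kronecker (K * Z) (row_mat v)"
proof (rule eq_matI)
  have KZ: "K * Z \<in> carrier_mat k n" using K Z by simp
  note C = kronecker_row_mat_right_carrier[OF Z v] kronecker_row_mat_right_carrier[OF KZ v]
  fix i l assume "i < dim_row (kronecker (K * Z) (row_mat v))"
    and "l < dim_col (kronecker (K * Z) (row_mat v))"
  then have i: "i < k" and l: "l < n * m" using C(2) by auto
  show "(K * kronecker Z (row_mat v)) $$ (i, l) = kronecker (K * Z) (row_mat v) $$ (i, l)"
    using K Z C i l div_mod_less_product[OF l]
    by (auto simp: kronecker_row_mat_right_index[OF Z v] kronecker_row_mat_right_index[OF KZ v]
        scalar_prod_def sum_distrib_right intro!: sum.cong)
qed (use K Z kronecker_row_mat_right_carrier[OF Z v]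
      kronecker_row_mat_right_carrier[OF mult_carrier_mat[OF K Z] v] in auto)

text \<open>Each entry of a Kronecker product is one product of two numbers, so taking absolute
  values gives equality and loses nothing.\<close>

lemma abs_mat_kronecker_row_mat_left:
  assumes "Y \<in> carrier_mat a m" "v \<in> carrier_vec n"
  shows "abs_mat (kronecker (row_mat v) Y) = kronecker (row_mat (abs_vec v)) (abs_mat Y)"
proof -
  have "abs_mat Y \<in> carrier_mat a m" "abs_vec v \<in> carrier_vec n" using assms by auto
  then show ?thesis
    using assms kronecker_row_mat_left_carrier[of Y a m v n]
      kronecker_row_mat_left_carrier[of "abs_mat Y" a m "abs_vec v" n]
    by (intro eq_matI) (auto simp: kronecker_row_mat_left_index[of _ a m _ n] abs_mult
        div_mod_less_product)
qed

lemma abs_mat_kronecker_row_mat_right: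
  assumes "Z \<in> carrier_mat a n" "v \<in> carrier_vec m"
  shows "abs_mat (kronecker Z (row_mat v)) = kronecker (abs_mat Z) (row_mat (abs_vec v))"
proof -
  have "abs_mat Z \<in> carrier_mat a n" "abs_vec v \<in> carrier_vec m" using assms by auto
  then show ?thesis
    using assms kronecker_row_mat_right_carrier[of Z a n v m]
      kronecker_row_mat_right_carrier[of "abs_mat Z" a n "abs_vec v" m]
    by (intro eq_matI) (auto simp: kronecker_row_mat_right_index[of _ a n _ m] abs_mult
        div_mod_less_product)
qed

text \<open>The range splits into \<open>n\<close> consecutive blocks of length \<open>m\<close>; on
  block \<open>j\<close> the quotient is constantly \<open>j\<close> and the remainder runs through
  all offsets.\<close>

lemma sum_div_mod:
  fixes f :: "nat \<Rightarrow> nat \<Rightarrow> real"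
  shows "(\<Sum>l<n * m. f (l div m) (l mod m)) = (\<Sum>j<n. \<Sum>a<m. f j a)"
proof -
  have "(\<Sum>l=j * m..<j * m + m. f (l div m) (l mod m)) = (\<Sum>a<m. f j a)" for j
    by (rule sum.reindex_bij_witness[of _ "\<lambda>a. j * m + a" "\<lambda>l. l - j * m"])
      (auto simp: div_add1_eq nat_le_iff_add)
  then show ?thesis
    using sum.nat_group[of "\<lambda>l. f (l div m) (l mod m)" m n, symmetric] by simp
qed

text \<open>The order \<open>n * m\<close> matches the column count of the Kronecker products and
  the shape required by \<open>div_mod_less_product\<close>.\<close>

lemma vec_of_mat_carrier:
  "A \<in> carrier_mat m n \<Longrightarrow> vec_of_mat A \<in> carrier_vec (n * m)"
  by (auto simp: vec_of_mat_def)

lemma vec_of_mat_index: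
  "A \<in> carrier_mat m n \<Longrightarrow> l < n * m \<Longrightarrow> vec_of_mat A $ l = A $$ (l mod m, l div m)"
  by (auto simp: vec_of_mat_def mult.commute)

text \<open>The identity for \<open>vec\<close> of a triple product, in the case where
  \<open>Y * A * v\<close> is already a column.\<close>

lemma kronecker_row_mat_left_mult_vec_of_mat:
  assumes Y: "Y \<in> carrier_mat a m" and v: "v \<in> carrier_vec n" and A: "A \<in> carrier_mat m n"
  shows "kronecker (row_mat v) Y *\<^sub>v vec_of_mat A = Y *\<^sub>v (A *\<^sub>v v)"
proof (rule eq_vecI)
  fix i assume "i < dim_vec (Y *\<^sub>v (A *\<^sub>v v))"
  then have i: "i < a" using Y by simp
  have "(kronecker (row_mat v) Y *\<^sub>v vec_of_mat A) $ i
      = (\<Sum>l<n * m. v $ (l div m) * Y $$ (i, l mod m) * A $$ (l mod m, l div m))"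
    using i kronecker_row_mat_left_carrier[OF Y v] vec_of_mat_carrier[OF A]
    by (auto simp: scalar_prod_def atLeast0LessThan vec_of_mat_index[OF A]
        kronecker_row_mat_left_index[OF Y v] intro!: sum.cong)
  also have "\<dots> = (\<Sum>j<n. \<Sum>e<m. v $ j * Y $$ (i, e) * A $$ (e, j))"
    by (rule sum_div_mod[of "\<lambda>j e. v $ j * Y $$ (i, e) * A $$ (e, j)"])
  \<comment> \<open>Column stacking puts the columns of \<open>A\<close> outermost, whereas
    \<open>Y *\<^sub>v (A *\<^sub>v v)\<close> sums over its rows outermost.\<close>
  also have "\<dots> = (\<Sum>e<m. \<Sum>j<n. v $ j * Y $$ (i, e) * A $$ (e, j))"
    by (rule sum.swap)
  also have "\<dots> = (Y *\<^sub>v (A *\<^sub>v v)) $ i"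
    using i Y v A
    by (auto simp: scalar_prod_def atLeast0LessThan sum_distrib_left intro!: sum.cong)
  finally show "(kronecker (row_mat v) Y *\<^sub>v vec_of_mat A) $ i = (Y *\<^sub>v (A *\<^sub>v v)) $ i" .
qed (use Y kronecker_row_mat_left_carrier[OF Y v] in auto)

text \<open>The transpose arises because \<open>v\<close> now pairs with the row index of
  \<open>A\<close>; the column index is outermost on both sides, so the sums are already in
  order.\<close>

lemma kronecker_row_mat_right_mult_vec_of_mat:
  assumes Z: "Z \<in> carrier_mat a n" and v: "v \<in> carrier_vec m" and A: "A \<in> carrier_mat m n"
  shows "kronecker Z (row_mat v) *\<^sub>v vec_of_mat A = Z *\<^sub>v (A\<^sup>T *\<^sub>v v)"
proof (rule eq_vecI)
  fix i assume "i < dim_vec (Z *\<^sub>v (A\<^sup>T *\<^sub>v v))"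
  then have i: "i < a" using Z by simp
  have "(kronecker Z (row_mat v) *\<^sub>v vec_of_mat A) $ i
      = (\<Sum>l<n * m. Z $$ (i, l div m) * v $ (l mod m) * A $$ (l mod m, l div m))"
    using i kronecker_row_mat_right_carrier[OF Z v] vec_of_mat_carrier[OF A]
    by (auto simp: scalar_prod_def atLeast0LessThan vec_of_mat_index[OF A]
        kronecker_row_mat_right_index[OF Z v] intro!: sum.cong)
  also have "\<dots> = (\<Sum>j<n. \<Sum>e<m. Z $$ (i, j) * v $ e * A $$ (e, j))"
    by (rule sum_div_mod[of "\<lambda>j e. Z $$ (i, j) * v $ e * A $$ (e, j)"])
  also have "\<dots> = (Z *\<^sub>v (A\<^sup>T *\<^sub>v v)) $ i"
    using i Z v A
    by (auto simp: scalar_prod_def atLeast0LessThan sum_distrib_left intro!: sum.cong)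
  finally show "(kronecker Z (row_mat v) *\<^sub>v vec_of_mat A) $ i = (Z *\<^sub>v (A\<^sup>T *\<^sub>v v)) $ i" .
qed (use Z kronecker_row_mat_right_carrier[OF Z v] in auto)

text \<open>The only place where an estimate is made. The two alternatives for \<open>X\<close>
  serve the \<open>B\<close> block, a sum, and the \<open>A\<close> block, a difference; absolute
  values erase the distinction.\<close>

lemma abs_kronecker_sum_le:
  fixes Y Z A :: "real mat"
  assumes Y: "Y \<in> carrier_mat a m" and Z: "Z \<in> carrier_mat a n"
    and v: "v \<in> carrier_vec n" and u: "u \<in> carrier_vec m"
    and A: "A \<in> carrier_mat m n" and i: "i < a"
    and X: "X = kronecker (row_mat v) Y + kronecker Z (row_mat u)
      \<or> X = kronecker (row_mat v) Y + - kronecker Z (row_mat u)"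
  shows "(abs_mat X *\<^sub>v vec_of_mat (abs_mat A)) $ i
    \<le> (abs_mat Y *\<^sub>v (abs_mat A *\<^sub>v abs_vec v)) $ i
      + (abs_mat Z *\<^sub>v (abs_mat A\<^sup>T *\<^sub>v abs_vec u)) $ i"
proof -
  let ?w = "vec_of_mat (abs_mat A)"
  have aA: "abs_mat A \<in> carrier_mat m n" using A by simp
  have w: "?w \<in> carrier_vec (n * m)" by (rule vec_of_mat_carrier[OF aA])
  have w0: "0 \<le> ?w $ l" if "l < n * m" for l
    using that A div_mod_less_product[OF that] by (simp add: vec_of_mat_index[OF aA])
  note KY = kronecker_row_mat_left_carrier[OF Y v]
  note KZ = kronecker_row_mat_right_carrier[OF Z u]
  have "(abs_mat X *\<^sub>v ?w) $ i \<le> (abs_mat (kronecker (row_mat v) Y) *\<^sub>v ?w) $ i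
      + (abs_mat (kronecker Z (row_mat u)) *\<^sub>v ?w) $ i"
    using X abs_mat_add_mult_vec_le[OF KY KZ w w0 i]
      abs_mat_add_mult_vec_le[OF KY uminus_carrier_mat[OF KZ] w w0 i]
    by (auto simp: abs_mat_uminus)
  also have "abs_mat (kronecker (row_mat v) Y) *\<^sub>v ?w = abs_mat Y *\<^sub>v (abs_mat A *\<^sub>v abs_vec v)"
    unfolding abs_mat_kronecker_row_mat_left[OF Y v]
    by (rule kronecker_row_mat_left_mult_vec_of_mat[OF _ _ aA]) (use Y v in auto)
  also have "abs_mat (kronecker Z (row_mat u)) *\<^sub>v ?w
      = abs_mat Z *\<^sub>v ((abs_mat A)\<^sup>T *\<^sub>v abs_vec u)"
    unfolding abs_mat_kronecker_row_mat_right[OF Z u]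
    by (rule kronecker_row_mat_right_mult_vec_of_mat[OF _ _ aA]) (use Z u in auto)
  finally show ?thesis by (simp add: map_mat_transpose)
qed

text \<open>Stacking and concatenation only rearrange entries, so entrywise maps pass through them.
  Instantiated with \<open>ddag_mat A\<close> and its analogues, it splits the weight of the
  condition numbers into four blocks.\<close>

lemma abs_ddag_vec_data:
  "abs_vec (ddag_vec (vec_data A B b d)) =
    vec_of_mat (abs_mat (ddag_mat A)) @\<^sub>v vec_of_mat (abs_mat (ddag_mat B)) @\<^sub>v
      abs_vec (ddag_vec b) @\<^sub>v abs_vec (ddag_vec d)"
proof -
  have "map_vec f (vec_of_mat X) = vec_of_mat (map_mat f X)" for f :: "real \<Rightarrow> real" and X
  proof (rule eq_vecI)
    fix l assume "l < dim_vec (vec_of_mat (map_mat f X))"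
    then have l: "l < dim_col X * dim_row X" by (simp add: vec_of_mat_def mult.commute)
    show "map_vec f (vec_of_mat X) $ l = vec_of_mat (map_mat f X) $ l"
      using l div_mod_less_product[OF l] by (simp add: vec_of_mat_def mult.commute)
  qed (simp add: vec_of_mat_def)
  moreover have "map_vec f (u @\<^sub>v w) = map_vec f u @\<^sub>v map_vec f w" for f :: "real \<Rightarrow> real" and u w
    by (auto intro!: eq_vecI)
  ultimately show ?thesis by (simp add: vec_data_def)
qed


section \<open>The bounds\<close>

text \<open>\<open>minv\<close> has a known dimension only for invertible arguments. Invertibility
  is \<open>schur_inj\<close> with the identity as positive definite matrix; the result fixes the
  dimension of the multiplier.\<close>

lemma gram_inv_carrier:
  assumes B: "B \<in> carrier_mat s n" and rk: "vec_space.rank s B = s"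
  shows "minv (B * B\<^sup>T) \<in> carrier_mat s s"
proof -
  have "0 < v \<bullet> v" if "v \<in> carrier_vec n" "v \<noteq> 0\<^sub>v n" for v :: "real vec"
    using conjugate_square_greater_0_vec[OF that(1)] that(2) by simp
  then have pd: "pos_def_mat (1\<^sub>m n)" by (auto simp: pos_def_mat_def)
  have "minv (1\<^sub>m n) = 1\<^sub>m n"
    using pos_def_inv[OF one_carrier_mat pd] by simp
  then show ?thesis
    using schur_inj[OF one_carrier_mat pd B rk] B
    by (intro minv_props(1)[of _ s]) auto
qed

theorem mainTheorem4:
  fixes p q m n s k :: nat
    and A B L J M N P :: "real mat"
    and b d x r lam Ubd :: "real vec"
  assumes m: "p + q = m"
    and A: "A \<in> carrier_mat m n"
    and B: "B \<in> carrier_mat s n"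
    and b: "b \<in> carrier_vec m"
    and d: "d \<in> carrier_vec s"
    and rank_B: "vec_space.rank s B = s"
    and J: "J = sig_mat p q"
    and pos_def: "pos_def_mat (A\<^sup>T * J * A)"
    and L: "L \<in> carrier_mat n k"
    and rank_L: "vec_space.rank n L = k"
    and x: "x = eils_sol p q A B b d"
    and M: "M = A\<^sup>T * J * A"
    and N: "N = B * minv M * B\<^sup>T"
    and P: "P = B\<^sup>T * minv N * B * minv M - 1\<^sub>m n"
    and r: "r = b - A *\<^sub>v x"
    and lam: "lam = - (minv (B * B\<^sup>T) * B * A\<^sup>T * J *\<^sub>v r)"
    and Ubd: "Ubd =
        abs_mat (L\<^sup>T * minv M * B\<^sup>T * minv N) *\<^sub>v
          (abs_vec (ddag_vec (ddag_vec d)) + abs_mat (ddag_mat (ddag_mat B)) *\<^sub>v abs_vec x)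
      + abs_mat (L\<^sup>T * P\<^sup>T * minv M * A\<^sup>T * J) *\<^sub>v
          (abs_vec (ddag_vec (ddag_vec b)) + abs_mat (ddag_mat (ddag_mat A)) *\<^sub>v abs_vec x)
      + abs_mat (L\<^sup>T * minv M * P) *\<^sub>v
          (abs_mat (ddag_mat (ddag_mat B\<^sup>T)) *\<^sub>v abs_vec lam
            + abs_mat (ddag_mat (ddag_mat A\<^sup>T)) *\<^sub>v abs_vec (J *\<^sub>v r))"
  shows "(L\<^sup>T *\<^sub>v x \<noteq> 0\<^sub>v k \<longrightarrow>
            mixed_cond p q L A B b d \<le> inf_norm Ubd / inf_norm (L\<^sup>T *\<^sub>v x)) \<and>
         componentwise_cond p q L A B b d \<le> inf_norm (vec_divide Ubd (abs_vec (L\<^sup>T *\<^sub>v x)))"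
proof -

  \<comment> \<open>Invertibility and dimensions\<close>
  have Jc: "J \<in> carrier_mat m m" using sig_mat_carrier[of p q] m J by simp
  have Mc: "M \<in> carrier_mat n n" using A Jc M by simp
  have pd: "pos_def_mat M" using pos_def M by simp
  note Mi = pos_def_inv(1)[OF Mc pd]
  have Nc: "N \<in> carrier_mat s s" using B Mi N by simp
  have Ni: "minv N \<in> carrier_mat s s"
    using minv_props(1)[OF Nc] schur_inj[OF Mc pd B rank_B, folded N] by blast
  have Pc: "P \<in> carrier_mat n n" using B Mi Ni P by auto
  \<comment> \<open>Unique existence makes the \<open>THE\<close> in \<open>eils_sol\<close> satisfy
    its predicate, which yields the dimension of \<open>x\<close>.\<close>
  have "is_eils_solution p q A B b d x"
    unfolding x eils_sol_def
    by (rule theI') (use ex1_eils_solution[of A p q n B s b d] A B b d rank_B pos_def m J in auto)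
  then have xc: "x \<in> carrier_vec n" using A by (simp add: is_eils_solution_def)
  have rc: "r \<in> carrier_vec m" using A b xc r by simp
  have Jrc: "J *\<^sub>v r \<in> carrier_vec m" using Jc by (metis carrier_matD(1) carrier_vecI dim_mult_mat_vec)
  have lamc: "lam \<in> carrier_vec s"
    using gram_inv_carrier[OF B rank_B] lam by (intro carrier_vecI) simp
  have Lt: "L\<^sup>T \<in> carrier_mat k n" and Pt: "P\<^sup>T \<in> carrier_mat n n"
    and At: "A\<^sup>T \<in> carrier_mat n m" and Bt: "B\<^sup>T \<in> carrier_mat n s"
    using L Pc A B by auto

  \<comment> \<open>The coefficient matrices of \<open>eils_MF\<close> and their projections by
    \<open>L\<^sup>T\<close>\<close>
  define Q where "Q = P\<^sup>T * minv M * A\<^sup>T * J"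
  define R where "R = minv M * B\<^sup>T * minv N"
  define Z where "Z = minv M * P"
  have Qc: "Q \<in> carrier_mat n m" unfolding Q_def using Pt Mi At Jc by (blast intro: mult_carrier_mat)
  have Rc: "R \<in> carrier_mat n s" unfolding R_def using Mi Bt Ni by (blast intro: mult_carrier_mat)
  have Zc: "Z \<in> carrier_mat n n" unfolding Z_def using Mi Pc by (rule mult_carrier_mat)
  define LQ where "LQ = L\<^sup>T * Q"
  define LR where "LR = L\<^sup>T * R"
  define LZ where "LZ = L\<^sup>T * Z"
  have LQc: "LQ \<in> carrier_mat k m" and LRc: "LR \<in> carrier_mat k s" and LZc: "LZ \<in> carrier_mat k n"
    using Lt Qc Rc Zc by (auto simp: LQ_def LR_def LZ_def)
  \<comment> \<open>\<open>Ubd\<close> associates these products to the left, whereas multiplying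
    \<open>eils_MF\<close> by \<open>L\<^sup>T\<close> produces \<open>L\<^sup>T * Q\<close>; the
    next three facts reconcile them.\<close>
  have LQ: "L\<^sup>T * P\<^sup>T * minv M * A\<^sup>T * J = LQ"
    unfolding LQ_def Q_def using Lt Pt Mi At Jc
    by (simp add: assoc_mult_mat[of _ k n _ n _ n] assoc_mult_mat[of _ k n _ n _ m]
        assoc_mult_mat[of _ k n _ m _ m])
  have LR: "L\<^sup>T * minv M * B\<^sup>T * minv N = LR"
    unfolding LR_def R_def using Lt Mi Bt Ni
    by (simp add: assoc_mult_mat[of _ k n _ n _ s] assoc_mult_mat[of _ k n _ s _ s])
  have LZ: "L\<^sup>T * minv M * P = LZ"
    unfolding LZ_def Z_def by (rule assoc_mult_mat[OF Lt Mi Pc])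

  \<comment> \<open>Block form of the projected matrix\<close>
  define Gam where "Gam = kronecker (row_mat x) Q - kronecker Z (row_mat (J *\<^sub>v r))"
  define Om where "Om = kronecker Z (row_mat lam) + kronecker (row_mat x) R"
  have K: "kronecker (row_mat x) Q \<in> carrier_mat n (n * m)"
    "kronecker Z (row_mat (J *\<^sub>v r)) \<in> carrier_mat n (n * m)"
    "kronecker Z (row_mat lam) \<in> carrier_mat n (n * s)"
    "kronecker (row_mat x) R \<in> carrier_mat n (n * s)"
    using Qc Zc Rc xc Jrc lamc by (auto intro!: kronecker_row_mat_carrier)
  have Gc: "Gam \<in> carrier_mat n (n * m)" and Oc: "Om \<in> carrier_mat n (n * s)"
    using K by (auto simp: Gam_def Om_def)
  have Mdef: "eils_M p q A = M" unfolding eils_M_def M J ..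
  have Ndef: "eils_N p q A B = N" unfolding eils_N_def Mdef N ..
  have Pdef: "eils_P p q A B = P" unfolding eils_P_def Mdef Ndef P using A by simp
  have rdef: "eils_residual p q A B b d = r" unfolding eils_residual_def r x ..
  have ldef: "eils_multiplier p q A B b d = lam" unfolding eils_multiplier_def rdef lam J ..
  have MF: "eils_MF p q A B b d
      = append_cols Gam (append_cols (- Om) (append_cols (- Q) R))"
    unfolding eils_MF_def Let_def Mdef Ndef Pdef rdef ldef x[symmetric] J[symmetric]
    by (simp add: Gam_def Om_def Q_def R_def Z_def)
  have LMF: "L\<^sup>T * eils_MF p q A B b d
      = append_cols (L\<^sup>T * Gam) (append_cols (- (L\<^sup>T * Om)) (append_cols (- LQ) LR))"
    unfolding MF LQ_def LR_def using Lt Gc Oc Qc Rc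
    by (simp add: mult_append_cols[of _ k n _ "n * m" _ "n * s + (m + s)"]
        mult_append_cols[of _ k n _ "n * s" _ "m + s"] mult_append_cols[of _ k n _ m _ s]
        append_cols_carrier)
  \<comment> \<open>The difference is written as a sum with a negated term, the second form accepted
    by \<open>abs_kronecker_sum_le\<close>.\<close>
  have LG: "L\<^sup>T * Gam = kronecker (row_mat x) LQ + - kronecker LZ (row_mat (J *\<^sub>v r))"
  proof -
    have "L\<^sup>T * Gam = L\<^sup>T * kronecker (row_mat x) Q - L\<^sup>T * kronecker Z (row_mat (J *\<^sub>v r))"
      unfolding Gam_def by (rule mult_minus_distrib_mat[OF Lt K(1,2)])
    then show ?thesis
      unfolding mult_kronecker_row_mat_left[OF Lt Qc xc] mult_kronecker_row_mat_right[OF Lt Zc Jrc]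
        LQ_def[symmetric] LZ_def[symmetric]
      using kronecker_row_mat_left_carrier[OF LQc xc] kronecker_row_mat_right_carrier[OF LZc Jrc]
      by (simp add: minus_add_uminus_mat)
  qed
  \<comment> \<open>The summands are exchanged to put the product with \<open>row_mat x\<close>
    first, as \<open>abs_kronecker_sum_le\<close> expects.\<close>
  have LO: "L\<^sup>T * Om = kronecker (row_mat x) LR + kronecker LZ (row_mat lam)"
  proof -
    have "L\<^sup>T * Om = L\<^sup>T * kronecker Z (row_mat lam) + L\<^sup>T * kronecker (row_mat x) R"
      unfolding Om_def by (rule mult_add_distrib_mat[OF Lt K(3,4)])
    then show ?thesis
      unfolding mult_kronecker_row_mat_left[OF Lt Rc xc] mult_kronecker_row_mat_right[OF Lt Zc lamc]
        LR_def[symmetric] LZ_def[symmetric]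
      using kronecker_row_mat_left_carrier[OF LRc xc] kronecker_row_mat_right_carrier[OF LZc lamc]
      by (simp add: comm_add_mat)
  qed

  \<comment> \<open>The weight vector and its four blocks\<close>
  \<comment> \<open>Applying \<open>ddag\<close> twice turns zeros into ones and keeps all other
    entries. \<open>A'\<close> and \<open>B'\<close> stay signed, since
    \<open>abs_kronecker_sum_le\<close> takes absolute values itself; \<open>b'\<close> and
    \<open>d'\<close> already include them.\<close>
  define A' where "A' = ddag_mat (ddag_mat A)"
  define B' where "B' = ddag_mat (ddag_mat B)"
  define b' where "b' = abs_vec (ddag_vec (ddag_vec b))"
  define d' where "d' = abs_vec (ddag_vec (ddag_vec d))"
  have A'c: "A' \<in> carrier_mat m n" and B'c: "B' \<in> carrier_mat s n"
    and b'c: "b' \<in> carrier_vec m" and d'c: "d' \<in> carrier_vec s"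
    using A B b d by (auto simp: A'_def B'_def b'_def d'_def)
  have aA'c: "abs_mat A' \<in> carrier_mat m n" and aB'c: "abs_mat B' \<in> carrier_mat s n"
    using A'c B'c by auto
  note wA = vec_of_mat_carrier[OF aA'c] and wB = vec_of_mat_carrier[OF aB'c]
  have LGc: "L\<^sup>T * Gam \<in> carrier_mat k (n * m)" and LOc: "L\<^sup>T * Om \<in> carrier_mat k (n * s)"
    using Lt Gc Oc by auto
  \<comment> \<open>Still an exact identity: the signs of the second and third block vanish under
    absolute values.\<close>
  have weighted: "eils_weighted p q L A B b d
      = abs_mat (L\<^sup>T * Gam) *\<^sub>v vec_of_mat (abs_mat A')
        + (abs_mat (L\<^sup>T * Om) *\<^sub>v vec_of_mat (abs_mat B') + (abs_mat LQ *\<^sub>v b' + abs_mat LR *\<^sub>v d'))"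
    unfolding eils_weighted_def LMF abs_ddag_vec_data A'_def[symmetric] B'_def[symmetric]
      b'_def[symmetric] d'_def[symmetric]
    using LGc LOc LQc LRc wA wB b'c d'c
    by (simp add: abs_mat_append_cols[of _ k "n * m" _ "n * s + (m + s)"]
        abs_mat_append_cols[of _ k "n * s" _ "m + s"] abs_mat_append_cols[of _ k m _ s]
        append_cols_mult_vec[of _ k "n * m" _ "n * s + (m + s)"]
        append_cols_mult_vec[of _ k "n * s" _ "m + s"] append_cols_mult_vec[of _ k m _ s]
        append_cols_carrier abs_mat_uminus)

  \<comment> \<open>Comparison with \<open>Ubd\<close>\<close>
  have w0: "0 \<le> vec_of_mat (abs_mat X) $ l" if "X \<in> carrier_mat a c" "l < c * a" for X a c l
    using that div_mod_less_product[OF that(2)] by (subst vec_of_mat_index[of _ a c]) auto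
  have xa: "abs_vec x \<in> carrier_vec n" using xc by simp
  have bnd: "Ubd = abs_mat LR *\<^sub>v (d' + abs_mat B' *\<^sub>v abs_vec x)
      + abs_mat LQ *\<^sub>v (b' + abs_mat A' *\<^sub>v abs_vec x)
      + abs_mat LZ *\<^sub>v (abs_mat B'\<^sup>T *\<^sub>v abs_vec lam + abs_mat A'\<^sup>T *\<^sub>v abs_vec (J *\<^sub>v r))"
    unfolding Ubd LQ LR LZ A'_def B'_def b'_def d'_def by (simp add: map_mat_transpose)
  \<comment> \<open>\<open>Ubd\<close> becomes six terms. Those with \<open>b'\<close> and
    \<open>d'\<close> occur verbatim in \<open>weighted\<close>; the other four pair up as the
    bounds for the \<open>A\<close> and \<open>B\<close> blocks.\<close>
  have t: "abs_mat LR *\<^sub>v (d' + abs_mat B' *\<^sub>v abs_vec x)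
        = abs_mat LR *\<^sub>v d' + abs_mat LR *\<^sub>v (abs_mat B' *\<^sub>v abs_vec x)"
      "abs_mat LQ *\<^sub>v (b' + abs_mat A' *\<^sub>v abs_vec x)
        = abs_mat LQ *\<^sub>v b' + abs_mat LQ *\<^sub>v (abs_mat A' *\<^sub>v abs_vec x)"
      "abs_mat LZ *\<^sub>v (abs_mat B'\<^sup>T *\<^sub>v abs_vec lam + abs_mat A'\<^sup>T *\<^sub>v abs_vec (J *\<^sub>v r))
        = abs_mat LZ *\<^sub>v (abs_mat B'\<^sup>T *\<^sub>v abs_vec lam)
          + abs_mat LZ *\<^sub>v (abs_mat A'\<^sup>T *\<^sub>v abs_vec (J *\<^sub>v r))"
    by (rule mult_add_distrib_mat_vec[of _ k s], use LRc d'c aB'c xa in auto)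
      (rule mult_add_distrib_mat_vec[of _ k m], use LQc b'c aA'c xa in auto,
       rule mult_add_distrib_mat_vec[of _ k n], use LZc A'c B'c lamc Jrc in auto)
  have dims: "dim_vec (eils_weighted p q L A B b d) = k" "dim_vec Ubd = k"
    unfolding weighted bnd using LRc LZc by auto
  have le: "\<bar>eils_weighted p q L A B b d $ i\<bar> \<le> \<bar>Ubd $ i\<bar>" if i: "i < k" for i
  proof -
    have 1: "(abs_mat (L\<^sup>T * Gam) *\<^sub>v vec_of_mat (abs_mat A')) $ i
        \<le> (abs_mat LQ *\<^sub>v (abs_mat A' *\<^sub>v abs_vec x)) $ i
          + (abs_mat LZ *\<^sub>v (abs_mat A'\<^sup>T *\<^sub>v abs_vec (J *\<^sub>v r))) $ i"
      by (rule abs_kronecker_sum_le[OF LQc LZc xc Jrc A'c i]) (simp add: LG)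
    have 2: "(abs_mat (L\<^sup>T * Om) *\<^sub>v vec_of_mat (abs_mat B')) $ i
        \<le> (abs_mat LR *\<^sub>v (abs_mat B' *\<^sub>v abs_vec x)) $ i
          + (abs_mat LZ *\<^sub>v (abs_mat B'\<^sup>T *\<^sub>v abs_vec lam)) $ i"
      by (rule abs_kronecker_sum_le[OF LRc LZc xc lamc B'c i]) (simp add: LO)
    have "eils_weighted p q L A B b d $ i \<le> Ubd $ i"
      unfolding weighted bnd t using 1 2 i LQc LRc LZc LGc LOc by simp
    \<comment> \<open>Nonnegativity of the smaller side turns the inequality into one between
      absolute values, the form used by both monotonicity lemmas.\<close>
    moreover have "0 \<le> eils_weighted p q L A B b d $ i"
      unfolding weighted
      using i LQc LRc LGc LOc abs_mat_mult_vec_nonneg[OF LGc wA w0[OF A'c] i]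
        abs_mat_mult_vec_nonneg[OF LOc wB w0[OF B'c] i]
        abs_mat_mult_vec_nonneg[OF LQc b'c _ i] abs_mat_mult_vec_nonneg[OF LRc d'c _ i] b d
      by (simp add: b'_def d'_def)
    ultimately show ?thesis by simp
  qed
  have "inf_norm (eils_weighted p q L A B b d) \<le> inf_norm Ubd"
    using dims le by (intro inf_norm_mono) auto
  then have "mixed_cond p q L A B b d \<le> inf_norm Ubd / inf_norm (L\<^sup>T *\<^sub>v x)"
    unfolding mixed_cond_def x[symmetric] by (intro divide_right_mono inf_norm_nonneg)
  moreover have "componentwise_cond p q L A B b d
      \<le> inf_norm (vec_divide Ubd (abs_vec (L\<^sup>T *\<^sub>v x)))"
    unfolding componentwise_cond_def x[symmetric]
    using dims le L by (intro inf_norm_vec_divide_mono) auto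
  ultimately show ?thesis by simp
qed

end
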